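(* Let $d\ge1$ and let $T$ be a random pseudometric over $\mathbb{R}^d$ which is ergodic under the action of the translations of $\mathbb{R}^d$, and Lipschitz: there exists a constant $C>0$ such that $T$ is $C$-Lipschitz for the Euclidean metric. Let $\mu:\mathbb{R}^d\to\mathbb{R}_+$ be its time constant, $\mu(v)=\lim_{n\to\infty}\frac1nT(0,nv)$ (almost sure and $L^1$ limit). For $t\ge0$ let $B_t=\{x\in\mathbb{R}^d: T(0,x)\le t\}$ and let $K=\{x\in\mathbb{R}^d:\mu(x)\le1\}$. Let $\mathbb{B}$ be the unit Euclidean ball of $\mathbb{R}^d$. 1. If $\mu=0$, then for every $M>0$, $$\mathbb{P}\Big[M\mathbb{B}\subset\tfrac1tB_t\text{ for all $t$ large enough}\Big]=1.$$ 2. If $\mu$ is a norm, then $K$ is a convex compact subset of $\mathbb{R}^d$ with non-empty interior, and for every $\epsilon>0$, $$\mathbb{P}\Big[(1-\epsilon)K\subset\tfrac1tB_t\subset(1+\epsilon)K\text{ for all $t$ large enough}\Big]=1.$$ If moreover the law of $T$ is invariant under the orthogonal group of $\mathbb{R}^d$, then $K=\frac1{\mu(1)}\mathbb{B}$, where $\mu(1)$ denotes $\mu(v)$ for any vector $v$ of Euclidean norm $1$.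
   Context: A pseudometric on $\mathbb{R}^d$ is a map $T:(\mathbb{R}^d)^2\to\mathbb{R}_+$ satisfying all axioms of a metric except possibly non-degeneracy. A random pseudometric is a random variable with values in the set of pseudometrics, equipped with the $\sigma$-algebra generated by the evaluations $T(x,y)$. Translations act by $\tau_v(T)(x,y)=T(v+x,v+y)$; $\tau_v$ is ergodic for the law of $T$ if the law is $\tau_v$-invariant and every $\tau_v$-invariant event has probability $0$ or $1$; $T$ is ergodic under translations if this holds for every $v\neq0$. Being $C$-Lipschitz implies $T(x,y)\le C\|x-y\|$, so $\mathbb{E}\,T(0,x)<\infty$ and the deterministic time constant $\mu$ exists.
   Formalization: The lower inclusion (1-ε)K ⊂ B_t/t is claimed only for 0<ε<2 (the upper one for every ε>0): since K=-K it fails for larger ε, e.g. T(x,y)=|x-y| on R with ε=3 gives [-2,2] ⊂ [-1,1]. *)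

theory Defs
  imports "HOL-Probability.Probability"
begin

definition pseudometric :: "('a \<times> 'a \<Rightarrow> real) \<Rightarrow> bool" where
  "pseudometric D \<longleftrightarrow>
     (\<forall>x y. 0 \<le> D (x, y)) \<and>
     (\<forall>x. D (x, x) = 0) \<and>
     (\<forall>x y. D (x, y) = D (y, x)) \<and>
     (\<forall>x y z. D (x, z) \<le> D (x, y) + D (y, z))"

text \<open>The set of pseudometrics with the \<open>\<sigma>\<close>-algebra generated by the evaluations at
  pairs of points.\<close>

definition pseudometric_algebra :: "('a \<times> 'a \<Rightarrow> real) measure" where
  "pseudometric_algebra =
     sigma {D. pseudometric D}
       {{D. pseudometric D \<and> D (x, y) \<in> A} | x y A. A \<in> sets borel}"

definition random_pseudometric :: "'w measure \<Rightarrow> ('w \<Rightarrow> 'a \<times> 'a \<Rightarrow> real) \<Rightarrow> bool" where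
  "random_pseudometric M T \<longleftrightarrow> T \<in> M \<rightarrow>\<^sub>M pseudometric_algebra"

definition law :: "'w measure \<Rightarrow> ('w \<Rightarrow> 'a \<times> 'a \<Rightarrow> real) \<Rightarrow> ('a \<times> 'a \<Rightarrow> real) measure" where
  "law M T = distr M pseudometric_algebra T"

definition pullback :: "('a \<Rightarrow> 'a) \<Rightarrow> ('a \<times> 'a \<Rightarrow> real) \<Rightarrow> 'a \<times> 'a \<Rightarrow> real" where
  "pullback g D = (\<lambda>(x, y). D (g x, g y))"

definition invariant_under :: "'b measure \<Rightarrow> ('b \<Rightarrow> 'b) \<Rightarrow> bool" where
  "invariant_under N f \<longleftrightarrow> f \<in> N \<rightarrow>\<^sub>M N \<and> distr N N f = N"

definition ergodic :: "'b measure \<Rightarrow> ('b \<Rightarrow> 'b) \<Rightarrow> bool" where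
  "ergodic N f \<longleftrightarrow> invariant_under N f \<and>
     (\<forall>A\<in>sets N. f -` A \<inter> space N = A \<longrightarrow> measure N A = 0 \<or> measure N A = 1)"

definition translation_ergodic ::
  "'w measure \<Rightarrow> ('w \<Rightarrow> 'a::real_vector \<times> 'a \<Rightarrow> real) \<Rightarrow> bool" where
  "translation_ergodic M T \<longleftrightarrow> (\<forall>v. v \<noteq> 0 \<longrightarrow> ergodic (law M T) (pullback ((+) v)))"

definition orthogonally_invariant ::
  "'w measure \<Rightarrow> ('w \<Rightarrow> 'a::real_inner \<times> 'a \<Rightarrow> real) \<Rightarrow> bool" where
  "orthogonally_invariant M T \<longleftrightarrow>
     (\<forall>g. orthogonal_transformation g \<longrightarrow> invariant_under (law M T) (pullback g))"

text \<open>The deterministic limit of \<open>T(0, n v) / n\<close>, both almost surely and in \<open>L\<^sup>1\<close>.\<close>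

definition is_time_constant ::
  "'w measure \<Rightarrow> ('w \<Rightarrow> 'a::real_vector \<times> 'a \<Rightarrow> real) \<Rightarrow> ('a \<Rightarrow> real) \<Rightarrow> bool" where
  "is_time_constant M T \<mu> \<longleftrightarrow>
     (\<forall>v. (AE \<omega> in M. (\<lambda>n. T \<omega> (0, real n *\<^sub>R v) / real n) \<longlonglongrightarrow> \<mu> v) \<and>
          (\<lambda>n. \<integral>\<^sup>+\<omega>. ennreal \<bar>T \<omega> (0, real n *\<^sub>R v) / real n - \<mu> v\<bar> \<partial>M) \<longlonglongrightarrow> 0)"

definition is_norm :: "('a::real_vector \<Rightarrow> real) \<Rightarrow> bool" where
  "is_norm N \<longleftrightarrow>
     (\<forall>x. 0 \<le> N x) \<and>
     (\<forall>x. N x = 0 \<longleftrightarrow> x = 0) \<and>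
     (\<forall>c x. N (c *\<^sub>R x) = \<bar>c\<bar> * N x) \<and>
     (\<forall>x y. N (x + y) \<le> N x + N y)"

definition pm_ball :: "('a::real_vector \<times> 'a \<Rightarrow> real) \<Rightarrow> real \<Rightarrow> 'a set" where
  "pm_ball D t = {x. D (0, x) \<le> t}"

text \<open>When \<open>\<mu>\<close> is a norm, \<open>K = limit_shape \<mu>\<close> satisfies \<open>K = - K\<close>, so for \<open>\<epsilon> > 1\<close> the dilate
  \<open>(1 - \<epsilon>) K\<close> is \<open>(\<epsilon> - 1) K\<close>.  An inclusion of \<open>(1 - \<epsilon>) K\<close> in the rescaled balls can therefore
  only be expected for \<open>\<epsilon> < 2\<close>.\<close>

definition limit_shape :: "('a \<Rightarrow> real) \<Rightarrow> 'a set" where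
  "limit_shape \<mu> = {x. \<mu> x \<le> 1}"

lemma space_pseudometric_algebra [simp]:
  "space pseudometric_algebra = {D. pseudometric D}"
  unfolding pseudometric_algebra_def by (rule space_measure_of) auto

lemma measurable_evaluation:
  "(\<lambda>D. D (x, y)) \<in> borel_measurable pseudometric_algebra"
proof (rule measurableI)
  fix A :: "real set" assume "A \<in> sets borel"
  then have "{D. pseudometric D \<and> D (x, y) \<in> A} \<in> sets pseudometric_algebra"
    unfolding pseudometric_algebra_def by (auto intro!: sigma_sets.Basic simp: sets_measure_of_conv)
  then show "(\<lambda>D. D (x, y)) -` A \<inter> space pseudometric_algebra \<in> sets pseudometric_algebra"
    by (simp add: vimage_def Int_def conj_commute)
qed simp

lemma pseudometric_pullback: "pseudometric D \<Longrightarrow> pseudometric (pullback g D)"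
  unfolding pseudometric_def pullback_def by auto

lemma measurable_pullback: "pullback g \<in> pseudometric_algebra \<rightarrow>\<^sub>M pseudometric_algebra"
proof -
  have "pullback g -` {D. pseudometric D \<and> D (x, y) \<in> A} \<inter> space pseudometric_algebra
      = (\<lambda>D. D (g x, g y)) -` A \<inter> space pseudometric_algebra" for x y A
    by (auto simp: pseudometric_pullback) (auto simp: pullback_def)
  moreover have "(\<lambda>D. D (g x, g y)) -` A \<inter> space pseudometric_algebra \<in> sets pseudometric_algebra"
    if "A \<in> sets borel" for x y A
    using measurable_sets[OF measurable_evaluation that] .
  ultimately show ?thesis
    unfolding pseudometric_algebra_def[where 'a='a]
    by (intro measurable_measure_of)
       (auto simp: pseudometric_pullback space_measure_of_conv pseudometric_algebra_def[symmetric])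
qed

end

(*
  Subtracting the time constant from x |-> T(0, x) leaves a Lipschitz function which is sublinear
  along every ray of a countable dense set of directions, almost surely.  The global Lipschitz bound
  and compactness of the unit sphere make this uniform: for every d > 0 there is A with
  |T(0, x) - mu x| <= d |x| + A for all x.  Both inclusions of balls follow by rescaling.
*)
theory Submission
  imports Defs
begin

section \<open>Sublinear bounds for Lipschitz functions\<close>

lemma affine_bound_of_sublinear_sequence:
  fixes a :: "nat \<Rightarrow> real"
  assumes "(\<lambda>n. a n / real n) \<longlonglongrightarrow> 0" and "0 < \<eta>"
  shows "\<exists>A\<ge>0. \<forall>n. \<bar>a n\<bar> \<le> \<eta> * real n + A"
proof -
  have "\<forall>\<^sub>F n in sequentially. dist (a n / real n) 0 < \<eta>"
    using assms by (rule tendstoD)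
  then obtain N where N: "\<And>n. n \<ge> N \<Longrightarrow> \<bar>a n / real n\<bar> < \<eta>"
    by (auto simp: eventually_sequentially)
  \<comment> \<open>The sum dominates each of the finitely many terms up to \<open>N\<close>. Index
    0 is among them: there \<open>a n / real n\<close> is 0 by convention and carries no information
    about \<open>a 0\<close>.\<close>
  define A where "A = (\<Sum>k\<le>N. \<bar>a k\<bar>)"
  have "\<bar>a n\<bar> \<le> \<eta> * real n + A" for n
  proof (cases "n \<le> N")
    case True
    then have "\<bar>a n\<bar> \<le> A"
      unfolding A_def by (intro member_le_sum) auto
    moreover have "0 \<le> \<eta> * real n"
      using \<open>0 < \<eta>\<close> by simp
    ultimately show ?thesis by linarith
  next
    case False
    then have "\<bar>a n\<bar> < \<eta> * real n"
      using N[of n] by (auto simp: abs_divide divide_simps)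
    moreover have "0 \<le> A"
      unfolding A_def by (intro sum_nonneg) auto
    ultimately show ?thesis by linarith
  qed
  moreover have "0 \<le> A"
    unfolding A_def by (intro sum_nonneg) auto
  ultimately show ?thesis by blast
qed

text \<open>By compactness finitely many directions of \<open>Q\<close> come close to every unit
  vector, so every \<open>x\<close> lies near an integer multiple of one of them. The Lipschitz
  bound pays for this displacement, and finitely many rays need only one additive constant.\<close>

lemma lipschitz_sublinear_on_dense_rays:
  fixes g :: "'a::euclidean_space \<Rightarrow> real"
  assumes lip: "L-lipschitz_on UNIV g"
    and dense: "\<And>X. open X \<Longrightarrow> X \<noteq> {} \<Longrightarrow> \<exists>q\<in>Q. q \<in> X"
    and rays: "\<And>q. q \<in> Q \<Longrightarrow> (\<lambda>n. g (real n *\<^sub>R q) / real n) \<longlonglongrightarrow> 0"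
    and "0 < \<delta>"
  shows "\<exists>A. \<forall>x. \<bar>g x\<bar> \<le> \<delta> * norm x + A"
proof -
  have L: "0 \<le> L" and lipD: "\<And>x y. \<bar>g x - g y\<bar> \<le> L * norm (x - y)"
    using lip by (auto simp: lipschitz_on_def dist_norm)
  \<comment> \<open>Moving to a ray costs \<open>L * \<eta>\<close> per unit of length and the bound
    on the ray costs \<open>\<eta>\<close>; together this is \<open>\<delta>\<close>. The summand 1
    also keeps the denominator positive when \<open>L = 0\<close>.\<close>
  define \<eta> where "\<eta> = \<delta> / (L + 1)"
  have \<eta>: "0 < \<eta>" "(L + 1) * \<eta> = \<delta>"
    using L \<open>0 < \<delta>\<close> by (auto simp: \<eta>_def)
  have "sphere (0::'a) 1 \<subseteq> (\<Union>q\<in>Q. ball q \<eta>)"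
  proof
    fix u :: 'a
    obtain q where "q \<in> Q" "q \<in> ball u \<eta>"
      using dense[of "ball u \<eta>"] \<eta> by auto
    then show "u \<in> (\<Union>q\<in>Q. ball q \<eta>)"
      by (auto simp: dist_commute)
  qed
  then obtain F where F: "F \<subseteq> Q" "finite F" "sphere 0 1 \<subseteq> (\<Union>q\<in>F. ball q \<eta>)"
    using compactE_image[OF compact_sphere, of Q "\<lambda>q. ball q \<eta>"] by blast
  have "\<exists>A\<ge>0. \<forall>n. \<bar>g (real n *\<^sub>R q)\<bar> \<le> \<eta> * real n + A" if "q \<in> F" for q
    using affine_bound_of_sublinear_sequence[OF rays] F \<eta> that by blast
  then obtain a where a0: "\<And>q. q \<in> F \<Longrightarrow> 0 \<le> a q"
    and a: "\<And>q n. q \<in> F \<Longrightarrow> \<bar>g (real n *\<^sub>R q)\<bar> \<le> \<eta> * real n + a q"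
    by metis
  define B where "B = sum a F"
  have B: "0 \<le> B" "\<And>q. q \<in> F \<Longrightarrow> a q \<le> B"
    unfolding B_def using F a0 by (auto intro!: member_le_sum sum_nonneg)
  \<comment> \<open>The three terms pay for rounding \<open>norm x\<close> to an integer, for the
    constants of the rays, and for \<open>x = 0\<close>, which has no direction.\<close>
  define A where "A = L * (1 + \<eta>) + B + \<bar>g 0\<bar>"
  have "\<bar>g x\<bar> \<le> \<delta> * norm x + A" for x
  proof (cases "x = 0")
    case True
    have "0 \<le> L * (1 + \<eta>)" using L \<eta> by simp
    then show ?thesis
      unfolding A_def using True B by simp
  next
    case False
    define r where "r = norm x"
    define u where "u = (1 / r) *\<^sub>R x"
    define n where "n = nat \<lfloor>r\<rfloor>"
    have r: "0 < r" and x: "x = r *\<^sub>R u" and "norm u = 1"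
      using False by (auto simp: r_def u_def)
    have n: "real n \<le> r" "r - real n \<le> 1"
      using r floor_correct[of r] by (simp_all add: n_def) linarith
    obtain q where q: "q \<in> F" "norm (u - q) < \<eta>"
      using F(3) \<open>norm u = 1\<close> by (fastforce simp: dist_norm norm_minus_commute)
    have "norm q \<le> 1 + \<eta>"
      using norm_triangle_sub[of q u] q \<open>norm u = 1\<close> by (simp add: norm_minus_commute)
    \<comment> \<open>The displacement splits into an error of direction, proportional to
      \<open>r\<close>, and a rounding error, which stays bounded.\<close>
    have "x - real n *\<^sub>R q = r *\<^sub>R (u - q) + (r - real n) *\<^sub>R q"
      by (simp add: x algebra_simps)
    then have "norm (x - real n *\<^sub>R q) \<le> r * norm (u - q) + (r - real n) * norm q"
      using r n norm_triangle_ineq[of "r *\<^sub>R (u - q)" "(r - real n) *\<^sub>R q"] by simp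
    also have "\<dots> \<le> r * \<eta> + 1 * (1 + \<eta>)"
      using r n q \<eta> \<open>norm q \<le> 1 + \<eta>\<close> by (intro add_mono mult_mono) auto
    finally have "L * norm (x - real n *\<^sub>R q) \<le> L * (r * \<eta> + (1 + \<eta>))"
      using L by (intro mult_left_mono) auto
    then have "\<bar>g x - g (real n *\<^sub>R q)\<bar> \<le> L * (r * \<eta> + (1 + \<eta>))"
      using lipD order_trans by blast
    moreover have "\<bar>g (real n *\<^sub>R q)\<bar> \<le> \<eta> * r + B"
      using a[OF q(1), of n] B(2)[OF q(1)] mult_left_mono[OF n(1), of \<eta>] \<eta> by linarith
    ultimately have "\<bar>g x\<bar> \<le> L * (r * \<eta> + (1 + \<eta>)) + \<eta> * r + B"
      by linarith
    also have "\<dots> = (L + 1) * \<eta> * r + L * (1 + \<eta>) + B"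
      by (simp add: algebra_simps)
    finally show ?thesis
      unfolding A_def r_def using \<eta>(2) by simp
  qed
  then show ?thesis by blast
qed

section \<open>Regularity of the time constant and uniform approximation by it\<close>

lemma lipschitz_on_pair_right:
  assumes "C-lipschitz_on UNIV (D :: 'a::metric_space \<times> 'a \<Rightarrow> real)"
  shows "C-lipschitz_on UNIV (\<lambda>x. D (z, x))"
proof (rule lipschitz_onI)
  show "dist (D (z, x)) (D (z, y)) \<le> C * dist x y" for x y
    using lipschitz_onD[OF assms, of "(z, x)" "(z, y)"] by (simp add: dist_Pair_Pair)
  show "0 \<le> C"
    using lipschitz_on_nonneg[OF assms] .
qed

lemma time_constant_AE:
  assumes "is_time_constant M T \<mu>"
  shows "AE \<omega> in M. (\<lambda>n. T \<omega> (0, real n *\<^sub>R v) / real n) \<longlonglongrightarrow> \<mu> v"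
  using assms by (simp add: is_time_constant_def)

text \<open>For each fixed pair of vectors the Lipschitz bound at \<open>n v\<close> and
  \<open>n w\<close>, divided by \<open>n\<close>, passes to the almost sure limit.\<close>

lemma time_constant_lipschitz:
  fixes T :: "'w \<Rightarrow> 'a::real_normed_vector \<times> 'a \<Rightarrow> real"
  assumes "prob_space M"
    and "AE \<omega> in M. C-lipschitz_on UNIV (T \<omega>)"
    and "is_time_constant M T \<mu>"
  shows "C-lipschitz_on UNIV \<mu>"
proof -
  interpret prob_space M by fact
  have "AE \<omega> in M. 0 \<le> C"
    using assms(2) by eventually_elim (rule lipschitz_on_nonneg)
  then have "0 \<le> C" by simp
  have "\<bar>\<mu> v - \<mu> w\<bar> \<le> C * norm (v - w)" for v w
  proof -
    \<comment> \<open>The inequality does not depend on \<open>\<omega>\<close>, so in a probability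
      space its almost sure validity is its validity.\<close>
    have "AE \<omega> in M. \<bar>\<mu> v - \<mu> w\<bar> \<le> C * norm (v - w)"
      using assms(2) time_constant_AE[OF assms(3), of v] time_constant_AE[OF assms(3), of w]
    proof eventually_elim
      case (elim \<omega>)
      have "(\<lambda>n. \<bar>T \<omega> (0, real n *\<^sub>R v) / real n - T \<omega> (0, real n *\<^sub>R w) / real n\<bar>)
          \<longlonglongrightarrow> \<bar>\<mu> v - \<mu> w\<bar>"
        using elim(2,3) by (intro tendsto_intros)
      moreover have "\<bar>T \<omega> (0, real n *\<^sub>R v) / real n - T \<omega> (0, real n *\<^sub>R w) / real n\<bar>
          \<le> C * norm (v - w)" for n
      proof (cases "n = 0")
        case False
        have "\<bar>T \<omega> (0, real n *\<^sub>R v) - T \<omega> (0, real n *\<^sub>R w)\<bar> \<le> C * norm (real n *\<^sub>R v - real n *\<^sub>R w)"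
          using lipschitz_onD[OF lipschitz_on_pair_right[OF elim(1), of 0],
              of "real n *\<^sub>R v" "real n *\<^sub>R w"]
          by (simp add: dist_norm)
        also have "\<dots> = real n * (C * norm (v - w))"
          by (simp add: scaleR_diff_right[symmetric])
        finally show ?thesis
          using False by (simp add: diff_divide_distrib[symmetric] divide_simps mult.commute)
      qed (use \<open>0 \<le> C\<close> in simp)
      ultimately show ?case
        by (intro tendsto_upperbound) auto
    qed
    then show ?thesis by simp
  qed
  with \<open>0 \<le> C\<close> show ?thesis
    by (auto intro!: lipschitz_onI simp: dist_norm)
qed

text \<open>A single null set serves all \<open>\<delta>\<close> and all \<open>x\<close>. The
  homogeneity \<open>hom\<close> turns convergence to \<open>\<mu> q\<close> along a ray into
  sublinearity of the difference from \<open>\<mu>\<close>; it holds both when \<open>\<mu>\<close>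
  vanishes and when it is a norm.\<close>

lemma uniform_time_constant:
  fixes T :: "'w \<Rightarrow> 'a::euclidean_space \<times> 'a \<Rightarrow> real"
  assumes "prob_space M"
    and lip: "AE \<omega> in M. C-lipschitz_on UNIV (T \<omega>)"
    and tc: "is_time_constant M T \<mu>"
    and hom: "\<And>n v. \<mu> (real n *\<^sub>R v) = real n * \<mu> v"
  shows "AE \<omega> in M. \<forall>\<delta>>0. \<exists>A. \<forall>x. \<bar>T \<omega> (0, x) - \<mu> x\<bar> \<le> \<delta> * norm x + A"
proof -
  obtain Q :: "'a set" where Q: "countable Q"
    and dense: "\<And>X. open X \<Longrightarrow> X \<noteq> {} \<Longrightarrow> \<exists>q\<in>Q. q \<in> X"
    using countable_dense_exists by blast
  \<comment> \<open>Countability of \<open>Q\<close> merges the exceptional null sets of the single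
    directions into one.\<close>
  have "AE \<omega> in M. \<forall>q\<in>Q. (\<lambda>n. T \<omega> (0, real n *\<^sub>R q) / real n) \<longlonglongrightarrow> \<mu> q"
    using time_constant_AE[OF tc] by (simp add: AE_ball_countable[OF Q])
  with lip show ?thesis
  proof eventually_elim
    case (elim \<omega>)
    have "(\<lambda>n. (T \<omega> (0, real n *\<^sub>R q) - \<mu> (real n *\<^sub>R q)) / real n) \<longlonglongrightarrow> 0" if "q \<in> Q" for q
    proof (rule Lim_transform_eventually)
      show "(\<lambda>n. T \<omega> (0, real n *\<^sub>R q) / real n - \<mu> q) \<longlonglongrightarrow> 0"
        using elim(2) that by (simp add: LIM_zero)
      \<comment> \<open>At \<open>n = 0\<close> division by zero gives \<open>- \<mu> q\<close> on
        the left and 0 on the right, hence only an eventual equality.\<close>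
      show "\<forall>\<^sub>F n in sequentially. T \<omega> (0, real n *\<^sub>R q) / real n - \<mu> q =
          (T \<omega> (0, real n *\<^sub>R q) - \<mu> (real n *\<^sub>R q)) / real n"
        using eventually_gt_at_top[of 0] by eventually_elim (simp add: hom diff_divide_distrib)
    qed
    moreover have "(C + C)-lipschitz_on UNIV (\<lambda>x. T \<omega> (0, x) - \<mu> x)"
      using lipschitz_on_pair_right[OF elim(1)] time_constant_lipschitz[OF assms(1) lip tc]
      by (intro lipschitz_on_diff)
    ultimately show ?case
      using lipschitz_sublinear_on_dense_rays[OF _ dense] by blast
  qed
qed

section \<open>Inclusions between rescaled balls and dilates of fixed sets\<close>

lemma scaleR_image_subset_rescaled_ball:
  assumes "0 < t" and "\<And>x. x \<in> S \<Longrightarrow> D (0, t *\<^sub>R s *\<^sub>R x) \<le> t"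
  shows "(*\<^sub>R) s ` S \<subseteq> (*\<^sub>R) (1 / t) ` pm_ball D t"
proof
  fix y assume "y \<in> (*\<^sub>R) s ` S"
  then have "t *\<^sub>R y \<in> pm_ball D t"
    using assms(2) by (auto simp: pm_ball_def)
  moreover have "y = (1 / t) *\<^sub>R t *\<^sub>R y"
    using \<open>0 < t\<close> by simp
  ultimately show "y \<in> (*\<^sub>R) (1 / t) ` pm_ball D t"
    by blast
qed

lemma zero_shape:
  fixes D :: "'a::real_normed_vector \<times> 'a \<Rightarrow> real"
  assumes close: "\<And>\<delta>. 0 < \<delta> \<Longrightarrow> \<exists>A. \<forall>x. \<bar>D (0, x)\<bar> \<le> \<delta> * norm x + A"
    and "0 < m"
  shows "\<forall>\<^sub>F t in at_top. (*\<^sub>R) m ` cball 0 1 \<subseteq> (*\<^sub>R) (1 / t) ` pm_ball D t"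
proof -
  \<comment> \<open>With this slope the linear error at \<open>t *\<^sub>R m *\<^sub>R x\<close> is
    at most \<open>t / 2\<close> for \<open>x\<close> in the unit ball; the other half of
    \<open>t\<close> absorbs \<open>A\<close> once \<open>t \<ge> 2 * A\<close>.\<close>
  obtain A where A: "\<And>x. \<bar>D (0, x)\<bar> \<le> 1 / (2 * m) * norm x + A"
    using close[of "1 / (2 * m)"] \<open>0 < m\<close> by auto
  show ?thesis
    using eventually_gt_at_top[of 0] eventually_ge_at_top[of "2 * A"]
  proof eventually_elim
    case (elim t)
    show ?case
    proof (rule scaleR_image_subset_rescaled_ball)
      fix x :: 'a assume "x \<in> cball 0 1"
      then have "t * norm x \<le> t"
        using elim by (simp add: mult_left_le)
      moreover have "1 / (2 * m) * norm (t *\<^sub>R m *\<^sub>R x) = t * norm x / 2"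
        using elim \<open>0 < m\<close> by simp
      ultimately show "D (0, t *\<^sub>R m *\<^sub>R x) \<le> t"
        using A[of "t *\<^sub>R m *\<^sub>R x"] elim by linarith
    qed (use elim in simp)
  qed
qed

lemma is_normD:
  assumes "is_norm N"
  shows "0 \<le> N x" "N x = 0 \<longleftrightarrow> x = 0" "N (c *\<^sub>R x) = \<bar>c\<bar> * N x" "N (x + y) \<le> N x + N y"
  using assms by (auto simp: is_norm_def)

text \<open>The minimum over the compact unit sphere is attained, hence positive, and homogeneity
  extends the bound. It converts errors measured by the Euclidean norm into errors measured by
  \<open>N\<close>.\<close>

lemma is_norm_lower_bound:
  fixes N :: "'a::euclidean_space \<Rightarrow> real"
  assumes N: "is_norm N" and cont: "continuous_on UNIV N"
  shows "\<exists>c>0. \<forall>x. c * norm x \<le> N x"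
proof -
  have "continuous_on (sphere 0 1) N"
    using cont continuous_on_subset by blast
  moreover have "sphere (0::'a) 1 \<noteq> {}"
    by simp
  ultimately obtain u where u: "norm u = 1" "\<And>y. norm y = 1 \<Longrightarrow> N u \<le> N y"
    using continuous_attains_inf[OF compact_sphere, of 0 1 N] by auto
  have "N u * norm x \<le> N x" for x
  proof (cases "x = 0")
    case False
    then have "N u \<le> N ((1 / norm x) *\<^sub>R x)"
      by (intro u(2)) simp
    then show ?thesis
      using False is_normD(3)[OF N] by (simp add: field_simps)
  qed (simp add: is_normD(1)[OF N])
  moreover have "0 < N u"
    using is_normD(1,2)[OF N, of u] u(1) by (metis norm_zero zero_neq_one order_le_less)
  ultimately show ?thesis by blast
qed

text \<open>Points of the dilate scaled by \<open>t\<close> have \<open>\<mu>\<close> at most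
  \<open>t * \<bar>s\<bar>\<close>, which leaves the room \<open>t * (1 - \<bar>s\<bar>)\<close> for
  the approximation error. The factor \<open>s\<close> may be negative, as
  \<open>1 - \<epsilon>\<close> is for \<open>\<epsilon> > 1\<close>.\<close>

lemma norm_shape_lower:
  fixes D :: "'a::real_normed_vector \<times> 'a \<Rightarrow> real" and \<mu> :: "'a \<Rightarrow> real"
  assumes N: "is_norm \<mu>" and c: "0 < c" "\<And>x. c * norm x \<le> \<mu> x"
    and close: "\<And>\<delta>. 0 < \<delta> \<Longrightarrow> \<exists>A. \<forall>x. \<bar>D (0, x) - \<mu> x\<bar> \<le> \<delta> * norm x + A"
    and "\<bar>s\<bar> < 1"
  shows "\<forall>\<^sub>F t in at_top. (*\<^sub>R) s ` limit_shape \<mu> \<subseteq> (*\<^sub>R) (1 / t) ` pm_ball D t"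
proof -
  \<comment> \<open>Half of the available room: one \<open>\<theta> * t\<close> is for the linear
    error, the other for \<open>A\<close>.\<close>
  define \<theta> where "\<theta> = (1 - \<bar>s\<bar>) / 2"
  have \<theta>: "0 < \<theta>" "\<bar>s\<bar> = 1 - 2 * \<theta>"
    using \<open>\<bar>s\<bar> < 1\<close> by (auto simp: \<theta>_def field_simps)
  \<comment> \<open>The factor \<open>c\<close> lets \<open>c * norm y \<le> \<mu> y\<close> turn
    the linear error into at most \<open>\<theta> * \<mu> y\<close>.\<close>
  obtain A where A: "\<And>x. \<bar>D (0, x) - \<mu> x\<bar> \<le> \<theta> * c * norm x + A"
    using close[of "\<theta> * c"] \<theta> c by auto
  show ?thesis
    using eventually_gt_at_top[of 0] eventually_ge_at_top[of "A / \<theta>"]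
  proof eventually_elim
    case (elim t)
    show ?case
    proof (rule scaleR_image_subset_rescaled_ball)
      fix x assume "x \<in> limit_shape \<mu>"
      then have x: "\<mu> x \<le> 1" by (simp add: limit_shape_def)
      define y where "y = t *\<^sub>R s *\<^sub>R x"
      have "\<mu> y = t * \<bar>s\<bar> * \<mu> x"
        unfolding y_def using elim by (simp add: is_normD(3)[OF N] abs_mult)
      also have "\<dots> \<le> t * \<bar>s\<bar>"
        using x elim by (simp add: mult_left_le)
      finally have y: "\<mu> y \<le> t * \<bar>s\<bar>" .
      moreover have "t * \<bar>s\<bar> \<le> t"
        using elim \<open>\<bar>s\<bar> < 1\<close> by (simp add: mult_left_le)
      ultimately have "\<theta> * (c * norm y) \<le> \<theta> * t"
        using c(2)[of y] \<theta> by (intro mult_left_mono) auto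
      moreover have "A \<le> \<theta> * t"
        using elim(2) \<theta> by (simp add: field_simps)
      moreover have "t * \<bar>s\<bar> = t - 2 * (\<theta> * t)"
        by (simp add: \<theta>(2) algebra_simps)
      ultimately show "D (0, t *\<^sub>R s *\<^sub>R x) \<le> t"
        using A[of y] y unfolding y_def[symmetric] by (simp add: mult.assoc)
    qed (use elim in simp)
  qed
qed

text \<open>No bound on the points of the random ball is known in advance, so the linear error is
  absorbed into \<open>\<mu> y\<close> itself, at the price of a factor
  \<open>1 - \<theta>\<close>.\<close>

lemma norm_shape_upper:
  fixes D :: "'a::real_normed_vector \<times> 'a \<Rightarrow> real" and \<mu> :: "'a \<Rightarrow> real"
  assumes N: "is_norm \<mu>" and c: "0 < c" "\<And>x. c * norm x \<le> \<mu> x"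
    and close: "\<And>\<delta>. 0 < \<delta> \<Longrightarrow> \<exists>A. \<forall>x. \<bar>D (0, x) - \<mu> x\<bar> \<le> \<delta> * norm x + A"
    and "0 < \<epsilon>"
  shows "\<forall>\<^sub>F t in at_top. (*\<^sub>R) (1 / t) ` pm_ball D t \<subseteq> (*\<^sub>R) (1 + \<epsilon>) ` limit_shape \<mu>"
proof -
  \<comment> \<open>chosen so that \<open>(1 - \<theta>) * (1 + \<epsilon>) = 1 + \<epsilon> / 2\<close>\<close>
  define \<theta> where "\<theta> = \<epsilon> / (2 * (1 + \<epsilon>))"
  have \<theta>: "0 < \<theta>" "\<theta> < 1" "(1 - \<theta>) * (1 + \<epsilon>) = 1 + \<epsilon> / 2"
    using \<open>0 < \<epsilon>\<close> by (auto simp: \<theta>_def field_simps)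
  obtain A where A: "\<And>x. \<bar>D (0, x) - \<mu> x\<bar> \<le> \<theta> * c * norm x + A"
    using close[of "\<theta> * c"] \<theta> c by auto
  show ?thesis
    using eventually_gt_at_top[of 0] eventually_ge_at_top[of "2 * A / \<epsilon>"]
  proof eventually_elim
    case (elim t)
    show ?case
    proof
      fix z assume "z \<in> (*\<^sub>R) (1 / t) ` pm_ball D t"
      then obtain y where z: "z = (1 / t) *\<^sub>R y" and y: "D (0, y) \<le> t"
        by (auto simp: pm_ball_def)
      have "\<theta> * (c * norm y) \<le> \<theta> * \<mu> y"
        using c(2) \<theta> by (intro mult_left_mono) auto
      then have "\<mu> y - \<theta> * \<mu> y \<le> t + A"
        using A[of y] y by (simp add: mult.assoc)
      \<comment> \<open>The choice of \<open>t\<close> gives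
        \<open>A \<le> t * \<epsilon> / 2\<close>.\<close>
      also have "\<dots> \<le> t * (1 + \<epsilon> / 2)"
        using elim(2) \<open>0 < \<epsilon>\<close> by (simp add: field_simps)
      also have "\<dots> = (1 - \<theta>) * (t * (1 + \<epsilon>))"
        by (subst \<theta>(3)[symmetric]) (simp only: mult_ac)
      finally have "(1 - \<theta>) * \<mu> y \<le> (1 - \<theta>) * (t * (1 + \<epsilon>))"
        by (simp add: algebra_simps)
      then have "\<mu> y \<le> t * (1 + \<epsilon>)"
        using \<theta>(2) by simp
      then have "\<mu> ((1 / (1 + \<epsilon>)) *\<^sub>R z) \<le> 1"
        using elim \<open>0 < \<epsilon>\<close> by (simp add: z is_normD(3)[OF N] divide_le_eq mult.commute)
      moreover have "z = (1 + \<epsilon>) *\<^sub>R (1 / (1 + \<epsilon>)) *\<^sub>R z"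
        using \<open>0 < \<epsilon>\<close> by simp
      ultimately show "z \<in> (*\<^sub>R) (1 + \<epsilon>) ` limit_shape \<mu>"
        unfolding limit_shape_def by blast
    qed
  qed
qed

section \<open>Geometry of the limit shape\<close>

lemma convex_limit_shape:
  assumes "is_norm \<mu>"
  shows "convex (limit_shape \<mu>)"
proof (rule convexI)
  fix x y and u v :: real
  assume xy: "x \<in> limit_shape \<mu>" "y \<in> limit_shape \<mu>" and uv: "0 \<le> u" "0 \<le> v" "u + v = 1"
  have "\<mu> (u *\<^sub>R x + v *\<^sub>R y) \<le> u * \<mu> x + v * \<mu> y"
    using is_normD(4)[OF assms, of "u *\<^sub>R x" "v *\<^sub>R y"] uv by (simp add: is_normD(3)[OF assms])
  also have "\<dots> \<le> u * 1 + v * 1"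
    using xy uv by (intro add_mono mult_left_mono) (auto simp: limit_shape_def)
  finally show "u *\<^sub>R x + v *\<^sub>R y \<in> limit_shape \<mu>"
    using uv by (simp add: limit_shape_def)
qed

lemma compact_limit_shape:
  fixes \<mu> :: "'a::euclidean_space \<Rightarrow> real"
  assumes "continuous_on UNIV \<mu>" and c: "0 < c" "\<And>x. c * norm x \<le> \<mu> x"
  shows "compact (limit_shape \<mu>)"
proof -
  have "closed (limit_shape \<mu>)"
    unfolding limit_shape_def using assms(1) by (intro closed_Collect_le continuous_intros)
  moreover have "norm x \<le> 1 / c" if "x \<in> limit_shape \<mu>" for x
    using c(2)[of x] c(1) that by (simp add: limit_shape_def field_simps)
  then have "bounded (limit_shape \<mu>)"
    by (auto simp: bounded_iff)
  ultimately show ?thesis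
    by (simp add: compact_eq_bounded_closed)
qed

lemma interior_limit_shape:
  fixes \<mu> :: "'a::real_normed_vector \<Rightarrow> real"
  assumes "continuous_on UNIV \<mu>" "is_norm \<mu>"
  shows "interior (limit_shape \<mu>) \<noteq> {}"
proof -
  \<comment> \<open>The strict sublevel set is an open part of the limit shape containing the
    origin.\<close>
  have "open {x. \<mu> x < 1}"
    using assms(1) by (intro open_Collect_less continuous_intros)
  then have "{x. \<mu> x < 1} \<subseteq> interior (limit_shape \<mu>)"
    by (intro interior_maximal) (auto simp: limit_shape_def)
  moreover have "\<mu> 0 = 0"
    using is_normD(2)[OF assms(2)] by blast
  then have "0 \<in> {x. \<mu> x < 1}"
    by simp
  ultimately show ?thesis by blast
qed

section \<open>Consequences of orthogonal invariance\<close>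

text \<open>The time constant depends only on the law of \<open>T\<close>. Since \<open>g\<close> is
  linear, the pulled back pseudometric sees along the ray of \<open>v\<close> what the original sees
  along the ray of \<open>g v\<close>, and both have the same law.\<close>

lemma time_constant_orthogonal:
  fixes T :: "'w \<Rightarrow> 'a::real_inner \<times> 'a \<Rightarrow> real"
  assumes "prob_space M"
    and T: "random_pseudometric M T"
    and tc: "is_time_constant M T \<mu>"
    and inv: "orthogonally_invariant M T" and g: "orthogonal_transformation g"
  shows "\<mu> (g v) = \<mu> v"
proof -
  interpret M: prob_space M by fact
  have mT: "T \<in> M \<rightarrow>\<^sub>M pseudometric_algebra"
    using T by (simp add: random_pseudometric_def)
  interpret L: prob_space "law M T"
    unfolding law_def by (rule M.prob_space_distr[OF mT])
  \<comment> \<open>Stating the convergence as an event on the space of pseudometrics allows its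
    transfer from \<open>M\<close> to the law and through \<open>pullback g\<close>. It is
    measurable because it involves countably many evaluations.\<close>
  define P where "P w D \<longleftrightarrow> (\<lambda>n. D (0, real n *\<^sub>R w) / real n) \<longlonglongrightarrow> \<mu> w"
    for w and D :: "'a \<times> 'a \<Rightarrow> real"
  note [measurable] = measurable_evaluation
  have meas: "{D \<in> space pseudometric_algebra. P w D} \<in> sets pseudometric_algebra" for w
    unfolding P_def by measurable
  have P: "AE D in law M T. P w D" for w
    using time_constant_AE[OF tc, of w]
    unfolding law_def AE_distr_iff[OF mT meas] by (simp add: P_def)
  have "linear g"
    using g by (rule orthogonal_transformation_linear)
  have invg: "pullback g \<in> law M T \<rightarrow>\<^sub>M law M T" "distr (law M T) (law M T) (pullback g) = law M T"
    using inv g by (auto simp: orthogonally_invariant_def invariant_under_def)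
  have "AE D in distr (law M T) (law M T) (pullback g). P v D"
    unfolding invg(2) by (rule P)
  then have "AE D in law M T. P v (pullback g D)"
    using meas[of v] by (subst (asm) AE_distr_iff[OF invg(1)]) (simp_all add: law_def)
  \<comment> \<open>For almost every \<open>D\<close> one sequence has both
    \<open>\<mu> (g v)\<close> and \<open>\<mu> v\<close> as its limit.\<close>
  with P[of "g v"] have "AE D in law M T. \<mu> (g v) = \<mu> v"
  proof eventually_elim
    case (elim D)
    have "(\<lambda>n. D (0, real n *\<^sub>R g v) / real n) \<longlonglongrightarrow> \<mu> v"
      using elim(2) by (simp add: P_def pullback_def linear_0[OF \<open>linear g\<close>] linear_cmul[OF \<open>linear g\<close>])
    with elim(1) show ?case
      unfolding P_def by (rule LIMSEQ_unique)
  qed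
  then show ?thesis by simp
qed

text \<open>Orthogonal maps act transitively on each sphere, so \<open>\<mu>\<close> is a multiple
  of the Euclidean norm.\<close>

lemma limit_shape_rotation_invariant:
  fixes \<mu> :: "real ^ 'n \<Rightarrow> real"
  assumes N: "is_norm \<mu>" and inv: "\<And>g v. orthogonal_transformation g \<Longrightarrow> \<mu> (g v) = \<mu> v"
    and v: "norm v = 1"
  shows "limit_shape \<mu> = (*\<^sub>R) (1 / \<mu> v) ` cball 0 1"
proof -
  have radial: "\<mu> x = norm x * \<mu> v" for x
  proof -
    obtain g where "orthogonal_transformation g" "g (norm x *\<^sub>R v) = x"
      using orthogonal_transformation_exists[of "norm x *\<^sub>R v" x] v by auto
    then have "\<mu> x = \<mu> (norm x *\<^sub>R v)"
      using inv by metis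
    then show ?thesis
      by (simp add: is_normD(3)[OF N])
  qed
  have "0 < \<mu> v"
    using is_normD(1,2)[OF N, of v] v by (metis norm_zero zero_neq_one order_le_less)
  then have "\<mu> x \<le> 1 \<longleftrightarrow> norm x \<le> 1 / \<mu> v" for x
    by (subst radial) (simp add: pos_le_divide_eq)
  then have "limit_shape \<mu> = cball 0 (1 / \<mu> v)"
    by (simp only: limit_shape_def cball_def dist_0_norm)
  also have "\<dots> = (*\<^sub>R) (1 / \<mu> v) ` cball 0 1"
    using \<open>0 < \<mu> v\<close> by (simp add: cball_scale)
  finally show ?thesis .
qed

theorem theorem2p7:
  fixes M :: "'w measure"
    and T :: "'w \<Rightarrow> (real ^ 'n) \<times> (real ^ 'n) \<Rightarrow> real"
    and \<mu> :: "real ^ 'n \<Rightarrow> real"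
  assumes "prob_space M"
    and "random_pseudometric M T"
    and "translation_ergodic M T"
    and "\<exists>C>0. AE \<omega> in M. C-lipschitz_on UNIV (T \<omega>)"
    and "is_time_constant M T \<mu>"
  shows "((\<forall>v. \<mu> v = 0) \<longrightarrow>
           (\<forall>m>0. AE \<omega> in M. \<forall>\<^sub>F t in at_top.
              (*\<^sub>R) m ` cball 0 1 \<subseteq> (*\<^sub>R) (1 / t) ` pm_ball (T \<omega>) t)) \<and>
         (is_norm \<mu> \<longrightarrow>
           convex (limit_shape \<mu>) \<and> compact (limit_shape \<mu>) \<and> interior (limit_shape \<mu>) \<noteq> {} \<and>
           (\<forall>\<epsilon>>0. AE \<omega> in M. \<forall>\<^sub>F t in at_top.
              (\<epsilon> < 2 \<longrightarrow> (*\<^sub>R) (1 - \<epsilon>) ` limit_shape \<mu> \<subseteq> (*\<^sub>R) (1 / t) ` pm_ball (T \<omega>) t) \<and>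
              (*\<^sub>R) (1 / t) ` pm_ball (T \<omega>) t \<subseteq> (*\<^sub>R) (1 + \<epsilon>) ` limit_shape \<mu>) \<and>
           (orthogonally_invariant M T \<longrightarrow>
              (\<forall>v. norm v = 1 \<longrightarrow> limit_shape \<mu> = (*\<^sub>R) (1 / \<mu> v) ` cball 0 1)))"
proof (intro conjI impI allI)
  obtain C where lip: "AE \<omega> in M. C-lipschitz_on UNIV (T \<omega>)"
    using assms(4) by blast
  note uniform = uniform_time_constant[OF assms(1) lip assms(5)]
  have cont: "continuous_on UNIV \<mu>"
    using time_constant_lipschitz[OF assms(1) lip assms(5)] by (rule lipschitz_on_continuous_on)
  {
    fix m :: real
    assume zero: "\<forall>v. \<mu> v = 0" and m: "0 < m"
    \<comment> \<open>The zero function is homogeneous, which is what \<open>uniform\<close> asks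
      for.\<close>
    have "AE \<omega> in M. \<forall>\<delta>>0. \<exists>A. \<forall>x. \<bar>T \<omega> (0, x) - \<mu> x\<bar> \<le> \<delta> * norm x + A"
      by (rule uniform) (simp add: zero)
    then show "AE \<omega> in M. \<forall>\<^sub>F t in at_top.
        (*\<^sub>R) m ` cball 0 1 \<subseteq> (*\<^sub>R) (1 / t) ` pm_ball (T \<omega>) t"
      by eventually_elim (rule zero_shape[OF _ m], simp add: zero)
  }
  assume N: "is_norm \<mu>"
  obtain c where c: "0 < c" "\<And>x. c * norm x \<le> \<mu> x"
    using is_norm_lower_bound[OF N cont] by blast
  show "convex (limit_shape \<mu>)"
    using N by (rule convex_limit_shape)
  show "compact (limit_shape \<mu>)"
    using cont c by (rule compact_limit_shape)
  show "interior (limit_shape \<mu>) \<noteq> {}"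
    using cont N by (rule interior_limit_shape)
  show "limit_shape \<mu> = (*\<^sub>R) (1 / \<mu> v) ` cball 0 1"
    if "orthogonally_invariant M T" "norm v = 1" for v
    using N time_constant_orthogonal[OF assms(1,2,5) that(1)] that(2)
    by (rule limit_shape_rotation_invariant)
  fix \<epsilon> :: real
  assume \<epsilon>: "0 < \<epsilon>"
  have "AE \<omega> in M. \<forall>\<delta>>0. \<exists>A. \<forall>x. \<bar>T \<omega> (0, x) - \<mu> x\<bar> \<le> \<delta> * norm x + A"
    by (rule uniform) (simp add: is_normD(3)[OF N])
  then show "AE \<omega> in M. \<forall>\<^sub>F t in at_top.
      (\<epsilon> < 2 \<longrightarrow> (*\<^sub>R) (1 - \<epsilon>) ` limit_shape \<mu> \<subseteq> (*\<^sub>R) (1 / t) ` pm_ball (T \<omega>) t) \<and>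
      (*\<^sub>R) (1 / t) ` pm_ball (T \<omega>) t \<subseteq> (*\<^sub>R) (1 + \<epsilon>) ` limit_shape \<mu>"
  proof eventually_elim
    case (elim \<omega>)
    then have close: "\<And>\<delta>. 0 < \<delta> \<Longrightarrow> \<exists>A. \<forall>x. \<bar>T \<omega> (0, x) - \<mu> x\<bar> \<le> \<delta> * norm x + A"
      by blast
    have "\<forall>\<^sub>F t in at_top.
        \<epsilon> < 2 \<longrightarrow> (*\<^sub>R) (1 - \<epsilon>) ` limit_shape \<mu> \<subseteq> (*\<^sub>R) (1 / t) ` pm_ball (T \<omega>) t"
    \<comment> \<open>Given \<open>0 < \<epsilon>\<close>, the condition
      \<open>\<epsilon> < 2\<close> says exactly that \<open>\<bar>1 - \<epsilon>\<bar> < 1\<close>;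
      otherwise the implication is vacuous.\<close>
    proof (cases "\<epsilon> < 2")
      case True
      then show ?thesis
        using norm_shape_lower[OF N c close, of "1 - \<epsilon>"] \<epsilon> by simp
    qed simp
    then show ?case
      using norm_shape_upper[OF N c close \<epsilon>] by (rule eventually_conj)
  qed
qed

end
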